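(* The class of $\{-,\triangleright\}$-algebras representable by partial functions is a variety, axiomatised by the following finite set of equations (where $a\cdot b$ abbreviates $a-(a-b)$): (Ax.1) $a-(b-a)=a$; (Ax.2) $a\cdot b=b\cdot a$; (Ax.3) $(a-b)-c=(a-c)-b$; (Ax.4) $(a\triangleright c)\cdot(b\triangleright c)=(a\triangleright b)\triangleright c$; (Ax.5) $(a\cdot b)\triangleright a=a\cdot b$. That is, an algebra $(A,-,\triangleright)$ with two binary operations is representable by partial functions if and only if it satisfies (Ax.1)–(Ax.5).
   Context: A partial function from $X$ to $Y$ is a subset $f\subseteq X\times Y$ such that $(x,y),(x,z)\in f$ implies $y=z$; its domain is $\mathrm{dom}(f)=\{x\mid \exists y\,(x,y)\in f\}$. An algebra of partial functions of signature $\{-,\triangleright\}$ is an algebra whose universe is a set of partial functions from a common set $X$ to a common set $Y$, closed under and equipped with relative complement $f-g=\{(x,y)\in f\mid (x,y)\notin g\}$ and domain restriction $f\triangleright g=\{(x,y)\in g\mid x\in\mathrm{dom}(f)\}$. A $\{-,\triangleright\}$-algebra is representable (by partial functions) if it is isomorphic to an algebra of partial functions; such an isomorphism is a representation. *)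

theory Defs
  imports Main
begin

section \<open>Algebras of signature difference, restriction\<close>

record 'a dr_algebra =
  carrier :: "'a set"
  diff :: "'a \<Rightarrow> 'a \<Rightarrow> 'a"
  restr :: "'a \<Rightarrow> 'a \<Rightarrow> 'a"

text \<open>The empty carrier is allowed: the signature has no constants.\<close>

definition dr_algebra :: "'a dr_algebra \<Rightarrow> bool" where
  "dr_algebra A \<longleftrightarrow>
     (\<forall>a\<in>carrier A. \<forall>b\<in>carrier A. diff A a b \<in> carrier A \<and> restr A a b \<in> carrier A)"

definition dr_iso :: "('a \<Rightarrow> 'b) \<Rightarrow> 'a dr_algebra \<Rightarrow> 'b dr_algebra \<Rightarrow> bool" where
  "dr_iso h A B \<longleftrightarrow> bij_betw h (carrier A) (carrier B) \<and>
     (\<forall>a\<in>carrier A. \<forall>b\<in>carrier A.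
        h (diff A a b) = diff B (h a) (h b) \<and> h (restr A a b) = restr B (h a) (h b))"


section \<open>Algebras of partial functions\<close>

definition partial_functions :: "'x set \<Rightarrow> 'y set \<Rightarrow> ('x \<times> 'y) set set" where
  "partial_functions X Y = {f. f \<subseteq> X \<times> Y \<and> single_valued f}"

definition dom_restr :: "('x \<times> 'y) set \<Rightarrow> ('x \<times> 'y) set \<Rightarrow> ('x \<times> 'y) set" where
  "dom_restr f g = {(x, y). (x, y) \<in> g \<and> x \<in> Domain f}"

definition pf_algebra :: "'x set \<Rightarrow> 'y set \<Rightarrow> ('x \<times> 'y) set dr_algebra \<Rightarrow> bool" where
  "pf_algebra X Y P \<longleftrightarrow> dr_algebra P \<and> carrier P \<subseteq> partial_functions X Y \<and>
     (\<forall>f\<in>carrier P. \<forall>g\<in>carrier P. diff P f g = f - g \<and> restr P f g = dom_restr f g)"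

text \<open>
  HOL cannot quantify over the types from which the base sets \<open>X\<close> and \<open>Y\<close> are drawn,
  so these types are parameters of representability.  For an algebra with carrier in \<open>'a\<close>
  the types \<open>'a set set\<close> and \<open>'a set\<close> are large enough: values can be taken to be
  ultrafilters of the algebra, and points to be sets of ultrafilters.
\<close>

definition representable_over :: "'x itself \<Rightarrow> 'y itself \<Rightarrow> 'a dr_algebra \<Rightarrow> bool" where
  "representable_over _ _ A \<longleftrightarrow>
     (\<exists>(X :: 'x set) (Y :: 'y set) P h. pf_algebra X Y P \<and> dr_iso h A P)"


section \<open>Equations\<close>

datatype dr_term =
    Var nat
  | Diff dr_term dr_term (infixl \<open>\<ominus>\<close> 65)
  | Restr dr_term dr_term (infixl \<open>\<triangleright>\<close> 70)

abbreviation Meet :: "dr_term \<Rightarrow> dr_term \<Rightarrow> dr_term" (infixl \<open>\<odot>\<close> 70) where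
  "s \<odot> t \<equiv> s \<ominus> (s \<ominus> t)"

primrec eval_term :: "'a dr_algebra \<Rightarrow> (nat \<Rightarrow> 'a) \<Rightarrow> dr_term \<Rightarrow> 'a" where
  "eval_term A v (Var i) = v i"
| "eval_term A v (s \<ominus> t) = diff A (eval_term A v s) (eval_term A v t)"
| "eval_term A v (s \<triangleright> t) = restr A (eval_term A v s) (eval_term A v t)"

definition satisfies :: "'a dr_algebra \<Rightarrow> (dr_term \<times> dr_term) set \<Rightarrow> bool" where
  "satisfies A E \<longleftrightarrow>
     (\<forall>(s, t)\<in>E. \<forall>v. range v \<subseteq> carrier A \<longrightarrow> eval_term A v s = eval_term A v t)"

definition dr_axioms :: "(dr_term \<times> dr_term) set" where
  "dr_axioms = (let a = Var 0; b = Var 1; c = Var 2 in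
     {(a \<ominus> (b \<ominus> a), a),
      (a \<odot> b, b \<odot> a),
      ((a \<ominus> b) \<ominus> c, (a \<ominus> c) \<ominus> b),
      ((a \<triangleright> c) \<odot> (b \<triangleright> c), (a \<triangleright> b) \<triangleright> c),
      ((a \<odot> b) \<triangleright> a, a \<odot> b)})"

end

theory Submission
  imports Defs
begin

text \<open>
  Soundness is a computation with partial functions.  For completeness, (Ax.1)--(Ax.3) make
  \<open>A\<close> a subtraction algebra, so it has enough ultrafilters.  The domain trace of an
  ultrafilter \<open>F\<close> is the set of all \<open>a\<close> with \<open>a \<triangleright> b \<in> F\<close> for some \<open>b \<in> F\<close>, which says that the
  point \<open>F\<close> lies over the domain of \<open>a\<close>.  Identifying ultrafilters with equal traces gives the
  points \<open>[F]\<close>, and \<open>a\<close> is represented by \<open>{([F], F) | a \<in> F}\<close>.  This is a partial function because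
  a trace together with one member determines the ultrafilter.  It respects \<open>\<triangleright>\<close> because, whenever
  \<open>a\<close> is in the trace of \<open>G\<close>, the set \<open>{c \<triangleright> a | c \<in> G}\<close> extends to an ultrafilter with the same
  trace as \<open>G\<close> that contains \<open>a\<close>.
\<close>

section \<open>Subtraction algebras\<close>

locale subtraction_algebra =
  fixes S :: "'a set" and sub :: "'a \<Rightarrow> 'a \<Rightarrow> 'a" (infixl "\<setminus>" 65)
  assumes sub_closed [simp]: "a \<in> S \<Longrightarrow> b \<in> S \<Longrightarrow> a \<setminus> b \<in> S"
    and sub_absorb: "a \<in> S \<Longrightarrow> b \<in> S \<Longrightarrow> a \<setminus> (b \<setminus> a) = a"
    and sub_swap: "a \<in> S \<Longrightarrow> b \<in> S \<Longrightarrow> a \<setminus> (a \<setminus> b) = b \<setminus> (b \<setminus> a)"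
    and sub_right_commute: "a \<in> S \<Longrightarrow> b \<in> S \<Longrightarrow> c \<in> S \<Longrightarrow> (a \<setminus> b) \<setminus> c = (a \<setminus> c) \<setminus> b"
begin

definition meet :: "'a \<Rightarrow> 'a \<Rightarrow> 'a" (infixl "\<sqinter>" 70) where
  "a \<sqinter> b = a \<setminus> (a \<setminus> b)"

text \<open>The signature has no constant, so zero is the self-difference of a chosen element; by
  \<open>sub_self_unique\<close> the choice is irrelevant. For empty \<open>S\<close> the value is
  arbitrary, hence the membership assumption in \<open>zero_closed\<close>.\<close>

definition zero :: 'a ("\<zero>") where
  "\<zero> = (SOME a. a \<in> S) \<setminus> (SOME a. a \<in> S)"

definition below :: "'a \<Rightarrow> 'a \<Rightarrow> bool" (infix "\<preceq>" 50) where
  "a \<preceq> b \<longleftrightarrow> a \<setminus> b = \<zero>"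

text \<open>Absorption and swap give \<open>a \<setminus> a = (b \<setminus> a) \<setminus> (b
  \<setminus> a)\<close> for all \<open>b\<close>. Applied twice, this reaches the self-difference
  of \<open>b \<setminus> (b \<setminus> a)\<close>, which is symmetric in \<open>a\<close> and
  \<open>b\<close>.\<close>

lemma sub_self_unique: "a \<in> S \<Longrightarrow> b \<in> S \<Longrightarrow> a \<setminus> a = b \<setminus> b"
  by (smt (verit) sub_absorb sub_closed sub_swap)

lemma sub_self [simp]: "a \<in> S \<Longrightarrow> a \<setminus> a = \<zero>"
  unfolding zero_def by (metis someI sub_self_unique)

lemma zero_closed: "a \<in> S \<Longrightarrow> \<zero> \<in> S"
  by (metis sub_self sub_closed)

lemma sub_zero [simp]: "a \<in> S \<Longrightarrow> a \<setminus> \<zero> = a"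
  by (metis sub_self sub_absorb)

lemma zero_sub [simp]: "a \<in> S \<Longrightarrow> \<zero> \<setminus> a = \<zero>"
  by (metis sub_zero sub_absorb zero_closed)

lemma meet_closed [simp]: "a \<in> S \<Longrightarrow> b \<in> S \<Longrightarrow> a \<sqinter> b \<in> S"
  by (simp add: meet_def)

lemma meet_commute: "a \<in> S \<Longrightarrow> b \<in> S \<Longrightarrow> a \<sqinter> b = b \<sqinter> a"
  by (simp add: meet_def sub_swap)

lemma meet_idem [simp]: "a \<in> S \<Longrightarrow> a \<sqinter> a = a"
  by (simp add: meet_def)

lemma zero_meet [simp]: "a \<in> S \<Longrightarrow> \<zero> \<sqinter> a = \<zero>"
  by (simp add: meet_def zero_closed)

lemma meet_zero [simp]: "a \<in> S \<Longrightarrow> a \<sqinter> \<zero> = \<zero>"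
  by (simp add: meet_def)

lemma below_refl [simp]: "a \<in> S \<Longrightarrow> a \<preceq> a"
  by (simp add: below_def)

section \<open>The natural order and its meets\<close>

lemma below_iff_meet:
  assumes "a \<in> S" "b \<in> S"
  shows "a \<preceq> b \<longleftrightarrow> a \<sqinter> b = a"
proof
  assume "a \<preceq> b"
  then show "a \<sqinter> b = a" using assms by (simp add: below_def meet_def)
next
  assume "a \<sqinter> b = a"
  then have "a \<setminus> b = (a \<setminus> (a \<setminus> b)) \<setminus> b" by (simp add: meet_def)
  also have "\<dots> = (a \<setminus> b) \<setminus> (a \<setminus> b)" using assms by (simp add: sub_right_commute)
  finally show "a \<preceq> b" using assms by (simp add: below_def)
qed

lemma below_antisym: "a \<in> S \<Longrightarrow> b \<in> S \<Longrightarrow> a \<preceq> b \<Longrightarrow> b \<preceq> a \<Longrightarrow> a = b"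
  by (metis below_iff_meet meet_commute)

lemma sub_below [simp]: "a \<in> S \<Longrightarrow> b \<in> S \<Longrightarrow> a \<setminus> b \<preceq> a"
  by (metis below_def sub_right_commute sub_self zero_sub)

lemma meet_below1 [simp]: "a \<in> S \<Longrightarrow> b \<in> S \<Longrightarrow> a \<sqinter> b \<preceq> a"
  by (simp add: meet_def)

lemma meet_below2 [simp]: "a \<in> S \<Longrightarrow> b \<in> S \<Longrightarrow> a \<sqinter> b \<preceq> b"
  by (metis meet_below1 meet_commute)

text \<open>Since \<open>a = b \<setminus> (b \<setminus> a)\<close>, right commutation exhibits
  \<open>a \<setminus> c\<close> as a difference taken from \<open>b \<setminus> c\<close>.\<close>

lemma sub_mono_left:
  assumes "a \<in> S" "b \<in> S" "c \<in> S" "a \<preceq> b"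
  shows "a \<setminus> c \<preceq> b \<setminus> c"
proof -
  have "a = b \<setminus> (b \<setminus> a)"
    using assms by (metis below_iff_meet meet_def sub_swap)
  then have "a \<setminus> c = (b \<setminus> c) \<setminus> (b \<setminus> a)"
    using assms by (metis sub_closed sub_right_commute)
  then show ?thesis using assms by simp
qed

lemma below_trans:
  assumes "a \<in> S" "b \<in> S" "c \<in> S" "a \<preceq> b" "b \<preceq> c"
  shows "a \<preceq> c"
  using sub_mono_left[of a b c] assms by (simp add: below_def)

lemma sub_antimono_right:
  assumes "a \<in> S" "b \<in> S" "c \<in> S" "b \<preceq> c"
  shows "a \<setminus> c \<preceq> a \<setminus> b"
proof -
  have "(a \<setminus> c) \<setminus> (a \<setminus> b) = (a \<sqinter> b) \<setminus> c"
    unfolding meet_def using assms by (simp add: sub_right_commute)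
  moreover have "a \<sqinter> b \<preceq> c"
    using assms below_trans[of "a \<sqinter> b" b c] by simp
  ultimately show ?thesis by (simp add: below_def)
qed

lemma meet_greatest:
  assumes "x \<in> S" "a \<in> S" "b \<in> S" "x \<preceq> a" "x \<preceq> b"
  shows "x \<preceq> a \<sqinter> b"
proof -
  \<comment> \<open>Here \<open>x \<preceq> b\<close> enters, through
    \<open>a \<setminus> b \<preceq> a \<setminus> x\<close>; absorption then collapses the
    left-hand side to \<open>x\<close>.\<close>
  have "x \<setminus> (a \<setminus> x) \<preceq> x \<setminus> (a \<setminus> b)"
    using assms by (intro sub_antimono_right) simp_all
  then have "x \<preceq> x \<setminus> (a \<setminus> b)" using assms by (simp add: sub_absorb)
  moreover have "x \<setminus> (a \<setminus> b) \<preceq> a \<sqinter> b"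
    unfolding meet_def using assms by (intro sub_mono_left) simp_all
  ultimately show ?thesis using assms below_trans[of x "x \<setminus> (a \<setminus> b)" "a \<sqinter> b"] by simp
qed

lemma meet_mono:
  assumes "a \<in> S" "b \<in> S" "c \<in> S" "d \<in> S" "a \<preceq> c" "b \<preceq> d"
  shows "a \<sqinter> b \<preceq> c \<sqinter> d"
  using assms below_trans[of "a \<sqinter> b" a c] below_trans[of "a \<sqinter> b" b d]
  by (intro meet_greatest) simp_all

lemma below_zero: "a \<in> S \<Longrightarrow> a \<preceq> \<zero> \<Longrightarrow> a = \<zero>"
  by (simp add: below_def)

lemma sub_meet_zero: "a \<in> S \<Longrightarrow> b \<in> S \<Longrightarrow> (a \<setminus> b) \<sqinter> b = \<zero>"
  by (simp add: meet_commute) (simp add: meet_def sub_absorb)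

lemma below_sub:
  assumes "x \<in> S" "a \<in> S" "b \<in> S" "x \<preceq> a" "x \<sqinter> b = \<zero>"
  shows "x \<preceq> a \<setminus> b"
proof -
  have "x = x \<setminus> (x \<sqinter> b)" using assms by simp
  \<comment> \<open>Both sides unfold to
    \<open>x \<setminus> (x \<setminus> (x \<setminus> b))\<close>.\<close>
  also have "\<dots> = x \<sqinter> (x \<setminus> b)" by (simp add: meet_def)
  finally have "x \<preceq> x \<setminus> b" using assms by (metis below_iff_meet sub_closed)
  then show ?thesis
    using assms sub_mono_left[of x a b] below_trans[of x "x \<setminus> b" "a \<setminus> b"] by simp
qed


section \<open>Ultrafilters\<close>

text \<open>Without a greatest element, the dichotomy is stated relative to each member
  \<open>a\<close>. The empty set also qualifies, but contributes no pair to any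
  \<open>rep a\<close>.\<close>

definition ultrafilter :: "'a set \<Rightarrow> bool" where
  "ultrafilter F \<longleftrightarrow> F \<subseteq> S \<and> \<zero> \<notin> F \<and> (\<forall>a\<in>F. \<forall>b\<in>F. a \<sqinter> b \<in> F)
     \<and> (\<forall>a\<in>F. \<forall>b\<in>S. a \<preceq> b \<longrightarrow> b \<in> F) \<and> (\<forall>a\<in>F. \<forall>b\<in>S. b \<in> F \<or> a \<setminus> b \<in> F)"

lemma ultrafilter_carrier: "ultrafilter F \<Longrightarrow> a \<in> F \<Longrightarrow> a \<in> S"
  by (auto simp: ultrafilter_def)

lemma ultrafilter_nonzero: "ultrafilter F \<Longrightarrow> \<zero> \<notin> F"
  by (simp add: ultrafilter_def)

lemma ultrafilter_meet: "ultrafilter F \<Longrightarrow> a \<in> F \<Longrightarrow> b \<in> F \<Longrightarrow> a \<sqinter> b \<in> F"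
  by (simp add: ultrafilter_def)

lemma ultrafilter_up: "ultrafilter F \<Longrightarrow> a \<in> F \<Longrightarrow> b \<in> S \<Longrightarrow> a \<preceq> b \<Longrightarrow> b \<in> F"
  by (simp add: ultrafilter_def)

lemma ultrafilter_sub_iff:
  assumes "ultrafilter F" "a \<in> S" "b \<in> S"
  shows "a \<setminus> b \<in> F \<longleftrightarrow> a \<in> F \<and> b \<notin> F"
proof
  assume ab: "a \<setminus> b \<in> F"
  then have "a \<in> F" using assms ultrafilter_up sub_below by blast
  moreover have "b \<notin> F"
    using ab assms ultrafilter_meet[of F "a \<setminus> b" b] ultrafilter_nonzero by (auto simp: sub_meet_zero)
  ultimately show "a \<in> F \<and> b \<notin> F" ..
next
  assume "a \<in> F \<and> b \<notin> F"
  then show "a \<setminus> b \<in> F" using assms unfolding ultrafilter_def by blast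
qed

text \<open>Upward closure is not demanded, so that a nonzero singleton qualifies, and so does the
  family \<open>B\<close> in \<open>ultrafilter_over_trace\<close>.\<close>

definition filter_base :: "'a set \<Rightarrow> bool" where
  "filter_base B \<longleftrightarrow> B \<subseteq> S \<and> \<zero> \<notin> B \<and> (\<forall>a\<in>B. \<forall>b\<in>B. a \<sqinter> b \<in> B)"

lemma filter_base_Union:
  assumes "\<C> \<noteq> {}" "\<And>B. B \<in> \<C> \<Longrightarrow> filter_base B" "\<And>B C. B \<in> \<C> \<Longrightarrow> C \<in> \<C> \<Longrightarrow> B \<subseteq> C \<or> C \<subseteq> B"
  shows "filter_base (\<Union>\<C>)"
  unfolding filter_base_def
proof (intro conjI ballI)
  show "\<Union>\<C> \<subseteq> S" "\<zero> \<notin> \<Union>\<C>" using assms(2) by (auto simp: filter_base_def)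
next
  fix a b assume "a \<in> \<Union>\<C>" "b \<in> \<Union>\<C>"
  then obtain B C where "a \<in> B" "B \<in> \<C>" "b \<in> C" "C \<in> \<C>" by blast
  then obtain D where "D \<in> \<C>" "a \<in> D" "b \<in> D" using assms(3) by blast
  then show "a \<sqinter> b \<in> \<Union>\<C>" using assms(2) by (auto simp: filter_base_def)
qed

text \<open>The filter generated by \<open>M\<close> and \<open>b\<close> is again a filter base,
  \<open>nz\<close> keeping zero out of it, so maximality makes it equal to
  \<open>M\<close>.\<close>

lemma maximal_filter_base_member:
  assumes M: "filter_base M" and max: "\<And>N. filter_base N \<Longrightarrow> M \<subseteq> N \<Longrightarrow> N = M"
    and b: "b \<in> S" and ne: "c0 \<in> M" and nz: "\<And>c. c \<in> M \<Longrightarrow> b \<sqinter> c \<noteq> \<zero>"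
  shows "b \<in> M"
proof -
  define N where "N = {x \<in> S. \<exists>c\<in>M. b \<sqinter> c \<preceq> x}"
  have MS: "\<And>c. c \<in> M \<Longrightarrow> c \<in> S" using M by (auto simp: filter_base_def)
  have "filter_base N"
    unfolding filter_base_def
  proof (intro conjI ballI)
    show "N \<subseteq> S" by (auto simp: N_def)
    show "\<zero> \<notin> N" using nz below_zero MS b by (force simp: N_def)
  next
    fix x y assume "x \<in> N" "y \<in> N"
    then obtain c d where *: "x \<in> S" "y \<in> S" "c \<in> M" "d \<in> M" "b \<sqinter> c \<preceq> x" "b \<sqinter> d \<preceq> y"
      by (auto simp: N_def)
    have cd: "c \<sqinter> d \<in> M" using * M by (auto simp: filter_base_def)
    have S: "c \<in> S" "d \<in> S" "c \<sqinter> d \<in> S" using * cd MS by auto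
    have "b \<sqinter> (c \<sqinter> d) \<preceq> b \<sqinter> c" "b \<sqinter> (c \<sqinter> d) \<preceq> b \<sqinter> d"
      using S b by (auto intro!: meet_mono)
    then have "b \<sqinter> (c \<sqinter> d) \<preceq> x" "b \<sqinter> (c \<sqinter> d) \<preceq> y"
      using * S b below_trans[of "b \<sqinter> (c \<sqinter> d)"] meet_closed by metis+
    then have "b \<sqinter> (c \<sqinter> d) \<preceq> x \<sqinter> y" using * S b by (intro meet_greatest) auto
    then show "x \<sqinter> y \<in> N" using * cd by (auto simp: N_def)
  qed
  moreover have "M \<subseteq> N" using MS b meet_below2 by (fastforce simp: N_def)
  ultimately have "N = M" by (rule max)
  moreover have "b \<in> N" using b ne MS by (auto simp: N_def intro!: bexI[of _ c0])
  ultimately show ?thesis by simp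
qed

text \<open>Zorn's lemma yields a maximal filter base above \<open>B\<close>; upward closure and the
  dichotomy both follow from \<open>maximal_filter_base_member\<close>.\<close>

lemma ultrafilter_extension:
  assumes B: "filter_base B" and "B \<noteq> {}"
  obtains F where "ultrafilter F" "B \<subseteq> F"
proof -
  have "\<exists>M\<in>{N. filter_base N \<and> B \<subseteq> N}. \<forall>N\<in>{N. filter_base N \<and> B \<subseteq> N}. M \<subseteq> N \<longrightarrow> N = M"
  proof (rule subset_Zorn_nonempty)
    show "{N. filter_base N \<and> B \<subseteq> N} \<noteq> {}" using B by blast
    fix \<C> assume "\<C> \<noteq> {}" "subset.chain {N. filter_base N \<and> B \<subseteq> N} \<C>"
    then show "\<Union>\<C> \<in> {N. filter_base N \<and> B \<subseteq> N}"
      by (auto simp: subset_chain_def intro!: filter_base_Union) blast+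
  qed
  then obtain M where "M \<in> {N. filter_base N \<and> B \<subseteq> N}"
    and *: "\<forall>N\<in>{N. filter_base N \<and> B \<subseteq> N}. M \<subseteq> N \<longrightarrow> N = M"
    by (rule bexE)
  then have M: "filter_base M" "B \<subseteq> M" by simp_all
  have max: "N = M" if "filter_base N" "M \<subseteq> N" for N
    using * that subset_trans[OF M(2) that(2)] by simp
  obtain c0 where c0: "c0 \<in> M" using M(2) \<open>B \<noteq> {}\<close> by blast
  have MS: "\<And>c. c \<in> M \<Longrightarrow> c \<in> S" and Mnz: "\<zero> \<notin> M"
    and Mmeet: "\<And>c d. c \<in> M \<Longrightarrow> d \<in> M \<Longrightarrow> c \<sqinter> d \<in> M"
    using M by (auto simp: filter_base_def)
  have member: "b \<in> M" if "b \<in> S" "\<And>c. c \<in> M \<Longrightarrow> b \<sqinter> c \<noteq> \<zero>" for b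
    using maximal_filter_base_member[OF M(1) max that(1) c0 that(2)] .
  have up: "b \<in> M" if "a \<in> M" "b \<in> S" "a \<preceq> b" for a b
  proof (rule member)
    fix c assume c: "c \<in> M"
    have "a \<sqinter> c \<preceq> b \<sqinter> c" using that c MS by (intro meet_mono) auto
    moreover have "a \<sqinter> c \<in> M" using that c Mmeet by blast
    ultimately show "b \<sqinter> c \<noteq> \<zero>" using below_zero Mnz MS by metis
  qed fact
  have "ultrafilter M"
    unfolding ultrafilter_def
  proof (intro conjI ballI impI)
    show "M \<subseteq> S" "\<zero> \<notin> M" using MS Mnz by auto
  next
    fix a b assume a: "a \<in> M" and b: "b \<in> S"
    show "b \<in> M \<or> a \<setminus> b \<in> M"
    proof (rule disjCI)
      assume "a \<setminus> b \<notin> M"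
      show "b \<in> M"
      \<comment> \<open>A member \<open>c\<close> disjoint from \<open>b\<close> would put
        \<open>a \<sqinter> c\<close> below \<open>a \<setminus> b\<close>, forcing the latter into
        \<open>M\<close>.\<close>
      proof (rule member[OF b], rule notI)
        fix c assume c: "c \<in> M" and bc: "b \<sqinter> c = \<zero>"
        have S: "a \<in> S" "c \<in> S" using a c MS by auto
        have "a \<sqinter> c \<sqinter> b \<preceq> c \<sqinter> b" using S b by (intro meet_mono) auto
        then have "a \<sqinter> c \<sqinter> b = \<zero>" using bc S b by (simp add: meet_commute below_zero)
        then have "a \<sqinter> c \<preceq> a \<setminus> b" using S b by (intro below_sub) auto
        then have "a \<setminus> b \<in> M" using up Mmeet a c S b sub_closed by blast
        with \<open>a \<setminus> b \<notin> M\<close> show False ..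
      qed
    qed
  qed (use up Mmeet in auto)
  with M(2) show thesis using that by blast
qed

lemma ultrafilter_containing:
  assumes "a \<in> S" "a \<noteq> \<zero>"
  obtains F where "ultrafilter F" "a \<in> F"
proof -
  have "filter_base {a}" using assms by (simp add: filter_base_def)
  then obtain F where "ultrafilter F" "{a} \<subseteq> F" using ultrafilter_extension by blast
  then show thesis using that by simp
qed

end


section \<open>Algebras satisfying the axioms\<close>

locale restriction_algebra = subtraction_algebra +
  fixes res :: "'a \<Rightarrow> 'a \<Rightarrow> 'a" (infixl "\<then>" 70)
  assumes res_closed [simp]: "a \<in> S \<Longrightarrow> b \<in> S \<Longrightarrow> a \<then> b \<in> S"
    and res_meet_res: "a \<in> S \<Longrightarrow> b \<in> S \<Longrightarrow> c \<in> S \<Longrightarrow>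
      (a \<then> c) \<setminus> ((a \<then> c) \<setminus> (b \<then> c)) = (a \<then> b) \<then> c"
    and meet_res: "a \<in> S \<Longrightarrow> b \<in> S \<Longrightarrow> (a \<setminus> (a \<setminus> b)) \<then> a = a \<setminus> (a \<setminus> b)"
begin

lemma res_res: "a \<in> S \<Longrightarrow> b \<in> S \<Longrightarrow> c \<in> S \<Longrightarrow> (a \<then> b) \<then> c = (a \<then> c) \<sqinter> (b \<then> c)"
  by (simp add: meet_def res_meet_res)

text \<open>The form in which \<open>meet_res\<close> is used from here on.\<close>

lemma res_of_below: "a \<in> S \<Longrightarrow> b \<in> S \<Longrightarrow> a \<preceq> b \<Longrightarrow> a \<then> b = a"
  by (metis below_iff_meet meet_commute meet_def meet_res)

lemma res_self [simp]: "a \<in> S \<Longrightarrow> a \<then> a = a"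
  by (simp add: res_of_below)

lemma zero_res [simp]: "a \<in> S \<Longrightarrow> \<zero> \<then> a = \<zero>"
  by (simp add: res_of_below below_def zero_closed)

text \<open>With \<open>y = a \<then> b\<close> and \<open>z = y \<sqinter> b\<close>, the idea is
  to rewrite \<open>y\<close> as \<open>(y \<then> b) \<then> y\<close>. This is
  \<open>z \<then> y\<close>, which equals \<open>z\<close> because
  \<open>z \<preceq> y\<close>.\<close>

lemma res_below [simp]:
  assumes "a \<in> S" "b \<in> S"
  shows "a \<then> b \<preceq> b"
proof -
  let ?y = "a \<then> b"
  let ?z = "?y \<sqinter> b"
  have z: "?z = ?y \<then> b" using assms by (simp add: res_res)
  \<comment> \<open>The left factor \<open>?y\<close> is read as \<open>a \<then> b\<close> and
    expanded by \<open>res_res\<close>.\<close>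
  have "?y \<then> ?y = (a \<then> ?y) \<sqinter> (b \<then> ?y)"
    using assms by (intro res_res) auto
  then have "?y = (a \<then> ?y) \<sqinter> (b \<then> ?y)" using assms by simp
  moreover have "(a \<then> ?y) \<sqinter> (b \<then> ?y) \<preceq> b \<then> ?y" using assms by simp
  ultimately have "?y \<preceq> b \<then> ?y" by simp
  then have "?y = ?y \<sqinter> (b \<then> ?y)" using assms below_iff_meet by simp
  also have "\<dots> = (?y \<then> b) \<then> ?y"
    using assms res_res[of ?y b ?y] by simp
  also have "\<dots> = ?z \<then> ?y" by (simp only: z)
  also have "\<dots> = ?z" using assms by (simp add: res_of_below)
  finally show ?thesis using assms below_iff_meet by simp
qed

text \<open>Both \<open>a \<then> b\<close> and \<open>b\<close> lie below \<open>c\<close>, so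
  \<open>(a \<then> b) \<then> c\<close> can be evaluated in two ways.\<close>

lemma res_to_smaller:
  assumes "a \<in> S" "b \<in> S" "c \<in> S" "b \<preceq> c"
  shows "a \<then> b = (a \<then> c) \<sqinter> b"
proof -
  have "a \<then> b \<preceq> c" using assms below_trans[of "a \<then> b" b c] by simp
  then have "a \<then> b = (a \<then> b) \<then> c" using assms by (simp add: res_of_below)
  also have "\<dots> = (a \<then> c) \<sqinter> b" using assms by (simp add: res_res res_of_below)
  finally show ?thesis .
qed

lemma res_mono_right: "a \<in> S \<Longrightarrow> b \<in> S \<Longrightarrow> c \<in> S \<Longrightarrow> b \<preceq> c \<Longrightarrow> a \<then> b \<preceq> a \<then> c"
  using res_to_smaller[of a b c] by simp

text \<open>For partial functions, \<open>a \<then> b = \<zero>\<close> says that the domains are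
  disjoint. In general, restricting \<open>b \<then> a\<close> to \<open>b\<close> gives zero, while
  restricting the result back to \<open>a\<close> recovers \<open>b \<then> a\<close>.\<close>

lemma res_zero_sym:
  assumes "a \<in> S" "b \<in> S" "a \<then> b = \<zero>"
  shows "b \<then> a = \<zero>"
proof -
  have "(b \<then> a) \<then> b = (a \<then> b) \<sqinter> b" using assms by (simp add: res_res meet_commute)
  then have "(b \<then> a) \<then> b = \<zero>" using assms by simp
  then have "\<zero> = ((b \<then> a) \<then> b) \<then> a" using assms by simp
  also have "\<dots> = ((b \<then> a) \<then> a) \<sqinter> (b \<then> a)" using assms by (intro res_res) auto
  also have "\<dots> = b \<then> a" using assms by (simp add: res_of_below)
  finally show ?thesis by simp
qed


section \<open>Domain traces\<close>

definition trace :: "'a set \<Rightarrow> 'a set" where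
  "trace F = {a \<in> S. \<exists>b\<in>F. a \<then> b \<in> F}"

text \<open>The witness in \<open>trace\<close> may be any member of \<open>F\<close>: membership
  passes from \<open>c\<close> down to \<open>c \<sqinter> b\<close> and, by monotonicity, up to
  \<open>b\<close>.\<close>

lemma trace_iff:
  assumes F: "ultrafilter F" and b: "b \<in> F" and a: "a \<in> S"
  shows "a \<in> trace F \<longleftrightarrow> a \<then> b \<in> F"
proof
  assume "a \<in> trace F"
  then obtain c where c: "c \<in> F" "a \<then> c \<in> F" by (auto simp: trace_def)
  have S: "b \<in> S" "c \<in> S" using F b c ultrafilter_carrier by auto
  have "a \<then> (c \<sqinter> b) = (a \<then> c) \<sqinter> (c \<sqinter> b)" using S a by (intro res_to_smaller) auto
  also have "\<dots> \<in> F" using F b c ultrafilter_meet by simp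
  finally have "a \<then> (c \<sqinter> b) \<in> F" .
  moreover have "a \<then> (c \<sqinter> b) \<preceq> a \<then> b" using S a by (intro res_mono_right) auto
  ultimately show "a \<then> b \<in> F" using ultrafilter_up[OF F, of "a \<then> (c \<sqinter> b)" "a \<then> b"] S a by simp
next
  assume "a \<then> b \<in> F"
  then show "a \<in> trace F" using a b unfolding trace_def by blast
qed

lemma ultrafilter_subset_trace: "ultrafilter F \<Longrightarrow> F \<subseteq> trace F"
  by (rule subsetI) (metis res_self trace_iff ultrafilter_carrier)

text \<open>A member \<open>c\<close> of \<open>F\<close> is encoded in the trace by
  \<open>a \<sqinter> c\<close>; restricting to the common member \<open>a\<close> decodes it in
  \<open>G\<close>, as \<open>(a \<sqinter> c) \<then> a = a \<sqinter> c\<close>.\<close>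

lemma ultrafilter_subset_of_trace:
  assumes F: "ultrafilter F" and G: "ultrafilter G" and eq: "trace F = trace G"
    and a: "a \<in> F" "a \<in> G"
  shows "F \<subseteq> G"
proof
  fix c assume c: "c \<in> F"
  have S: "a \<in> S" "c \<in> S" using a(1) c by (auto intro: ultrafilter_carrier[OF F])
  have "a \<sqinter> c \<in> F" using F a c ultrafilter_meet by blast
  then have "a \<sqinter> c \<in> trace G" using ultrafilter_subset_trace[OF F] eq by blast
  then have "(a \<sqinter> c) \<then> a \<in> G" using trace_iff[OF G a(2)] S by simp
  then have "a \<sqinter> c \<in> G" using S by (simp add: res_of_below)
  then show "c \<in> G" using G S ultrafilter_up meet_below2 by blast
qed

lemma ultrafilter_eq_of_trace:
  "ultrafilter F \<Longrightarrow> ultrafilter G \<Longrightarrow> trace F = trace G \<Longrightarrow> a \<in> F \<Longrightarrow> a \<in> G \<Longrightarrow> F = G"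
  by (rule subset_antisym) (simp_all add: ultrafilter_subset_of_trace)

lemma ultrafilter_over_trace:
  assumes G: "ultrafilter G" and b: "b \<in> G" and a: "a \<in> trace G"
  obtains F where "ultrafilter F" "a \<in> F" "trace F = trace G"
proof -
  have S: "a \<in> S" "b \<in> S" using a ultrafilter_carrier[OF G b] by (auto simp: trace_def)
  have GS: "\<And>c. c \<in> G \<Longrightarrow> c \<in> S" by (rule ultrafilter_carrier[OF G])
  define B where "B = (\<lambda>c. c \<then> a) ` G"
  have "filter_base B"
    unfolding filter_base_def
  proof (intro conjI ballI)
    show "B \<subseteq> S" using GS S by (auto simp: B_def)
    show "\<zero> \<notin> B"
    proof
      assume "\<zero> \<in> B"
      then obtain c where c: "c \<in> G" "c \<then> a = \<zero>" by (auto simp: B_def)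
      \<comment> \<open>As \<open>a\<close> is in the trace, its domain cannot be disjoint from that
        of a member of \<open>G\<close>.\<close>
      have "a \<then> c \<in> G" using trace_iff[OF G c(1)] a S by simp
      moreover have "a \<then> c = \<zero>" using res_zero_sym c GS S by simp
      ultimately show False using ultrafilter_nonzero G by simp
    qed
  next
    fix x y assume "x \<in> B" "y \<in> B"
    then obtain c d where cd: "c \<in> G" "d \<in> G" "x = c \<then> a" "y = d \<then> a" by (auto simp: B_def)
    then have "c \<then> d \<in> G"
      using trace_iff[OF G cd(2)] ultrafilter_subset_trace[OF G] GS by blast
    moreover have "x \<sqinter> y = (c \<then> d) \<then> a" using cd GS S by (simp add: res_res)
    ultimately show "x \<sqinter> y \<in> B" by (auto simp: B_def)
  qed
  moreover have "B \<noteq> {}" using b by (auto simp: B_def)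
  ultimately obtain F where F: "ultrafilter F" "B \<subseteq> F" using ultrafilter_extension by blast
  have inF: "c \<then> a \<in> F" if "c \<in> G" for c using that F by (auto simp: B_def)
  have aF: "a \<in> F" using ultrafilter_up[OF F(1) inF[OF b]] S by simp
  have "trace F = trace G"
  proof (intro equalityI subsetI)
    fix e assume e: "e \<in> trace G"
    then have eS: "e \<in> S" by (simp add: trace_def)
    \<comment> \<open>Hence \<open>(e \<then> b) \<then> a\<close> lies in \<open>B\<close>, and
      \<open>res_res\<close> places it below \<open>e \<then> a\<close>.\<close>
    have "e \<then> b \<in> G" using trace_iff[OF G b eS] e by simp
    then have "(e \<then> a) \<sqinter> (b \<then> a) \<in> F" using inF[of "e \<then> b"] eS S by (simp add: res_res)
    then have "e \<then> a \<in> F" using ultrafilter_up[OF F(1)] eS S by (metis meet_below1 res_closed)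
    then show "e \<in> trace F" using trace_iff[OF F(1) aF eS] by simp
  next
    fix e assume e: "e \<in> trace F"
    then have eS: "e \<in> S" by (simp add: trace_def)
    have ea: "e \<then> a \<in> F" using trace_iff[OF F(1) aF eS] e by simp
    show "e \<in> trace G"
    proof (rule ccontr)
      assume "e \<notin> trace G"
      then have eb: "e \<then> b \<notin> G" using trace_iff[OF G b eS] by simp
      \<comment> \<open>\<open>c\<close> is the part of \<open>b\<close> outside the domain of
        \<open>e\<close>. It belongs to \<open>G\<close>, so \<open>F\<close> contains both
        \<open>c \<then> a\<close> and \<open>e \<then> a\<close>, although \<open>c\<close> and
        \<open>e\<close> have disjoint domains.\<close>
      define c where "c = b \<setminus> (e \<then> b)"
      have c: "c \<in> G" unfolding c_def using eb b G eS S by (simp add: ultrafilter_sub_iff)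
      have cS: "c \<in> S" using c GS by blast
      have "e \<then> c = (e \<then> b) \<sqinter> c" unfolding c_def using eS S by (intro res_to_smaller) auto
      also have "\<dots> = \<zero>" unfolding c_def using eS S by (metis meet_commute res_closed sub_closed sub_meet_zero)
      finally have "c \<then> e = \<zero>" using res_zero_sym eS cS by blast
      then have "\<zero> = (c \<then> e) \<then> a" using S by simp
      also have "\<dots> = (c \<then> a) \<sqinter> (e \<then> a)" using cS eS S by (simp add: res_res)
      also have "\<dots> \<in> F" using ultrafilter_meet F(1) inF[OF c] ea by blast
      finally show False using ultrafilter_nonzero F(1) by blast
    qed
  qed
  with F aF that show thesis by blast
qed


section \<open>The ultrafilter representation\<close>

definition point :: "'a set \<Rightarrow> 'a set set" where
  "point F = {G. ultrafilter G \<and> trace G = trace F}"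

definition rep :: "'a \<Rightarrow> ('a set set \<times> 'a set) set" where
  "rep a = {(point F, F) | F. ultrafilter F \<and> a \<in> F}"

lemma point_eq_iff: "ultrafilter F \<Longrightarrow> point F = point G \<longleftrightarrow> trace F = trace G"
  by (auto simp: point_def)

lemma single_valued_rep: "single_valued (rep a)"
  by (auto simp: single_valued_def rep_def point_eq_iff dest: ultrafilter_eq_of_trace)

lemma rep_sub: "a \<in> S \<Longrightarrow> b \<in> S \<Longrightarrow> rep (a \<setminus> b) = rep a - rep b"
  by (auto simp: rep_def ultrafilter_sub_iff)

text \<open>The restriction law for \<open>rep\<close> at \<open>G\<close>: the existential says
  that \<open>point G\<close> lies in the domain of \<open>rep a\<close>.\<close>

lemma ultrafilter_res_iff:
  assumes G: "ultrafilter G" and "a \<in> S" "b \<in> S"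
  shows "a \<then> b \<in> G \<longleftrightarrow> b \<in> G \<and> (\<exists>F. ultrafilter F \<and> a \<in> F \<and> trace F = trace G)"
proof
  assume ab: "a \<then> b \<in> G"
  then have b: "b \<in> G" using ultrafilter_up[OF G ab] assms by simp
  then have "a \<in> trace G" using ab assms trace_iff by blast
  then show "b \<in> G \<and> (\<exists>F. ultrafilter F \<and> a \<in> F \<and> trace F = trace G)"
    using ultrafilter_over_trace[OF G b] b by metis
next
  assume "b \<in> G \<and> (\<exists>F. ultrafilter F \<and> a \<in> F \<and> trace F = trace G)"
  then show "a \<then> b \<in> G" using ultrafilter_subset_trace trace_iff[OF G] assms by blast
qed

lemma rep_res: "a \<in> S \<Longrightarrow> b \<in> S \<Longrightarrow> rep (a \<then> b) = dom_restr (rep a) (rep b)"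
  by (auto simp: rep_def dom_restr_def Domain_iff point_eq_iff ultrafilter_res_iff)
    (metis point_eq_iff)+

lemma inj_on_rep: "inj_on rep S"
proof (rule inj_onI)
  have below: "a \<preceq> b" if S: "a \<in> S" "b \<in> S" and eq: "rep a = rep b" for a b
  proof (rule ccontr)
    assume "\<not> a \<preceq> b"
    \<comment> \<open>A nonzero \<open>a \<setminus> b\<close> lies in some ultrafilter, which gives
      a pair in \<open>rep a - rep b\<close>.\<close>
    then obtain F where F: "ultrafilter F" "a \<setminus> b \<in> F"
      using ultrafilter_containing[of "a \<setminus> b"] S by (auto simp: below_def)
    then have "(point F, F) \<in> rep (a \<setminus> b)" by (auto simp: rep_def)
    then show False using S eq by (simp add: rep_sub)
  qed
  fix a b assume "a \<in> S" "b \<in> S" "rep a = rep b"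
  then show "a = b" using below below_antisym by metis
qed

end

section \<open>From the equations to a representation\<close>

theorem representable_of_axioms:
  fixes A :: "'a dr_algebra"
  assumes "restriction_algebra (carrier A) (diff A) (restr A)"
  shows "representable_over TYPE('a set set) TYPE('a set) A"
proof -
  interpret restriction_algebra "carrier A" "diff A" "restr A" by fact
  define P where "P = \<lparr>carrier = rep ` carrier A, diff = (-), restr = dom_restr\<rparr>"
  have "dr_algebra P"
    by (auto simp: dr_algebra_def P_def simp flip: rep_sub rep_res)
  then have "pf_algebra UNIV UNIV P"
    by (auto simp: pf_algebra_def partial_functions_def P_def single_valued_rep)
  moreover have "dr_iso rep A P"
    by (auto simp: dr_iso_def P_def bij_betw_def inj_on_rep rep_sub rep_res)
  ultimately show ?thesis unfolding representable_over_def by blast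
qed

lemma restriction_algebra_of_satisfies:
  assumes A: "dr_algebra A" and sat: "satisfies A dr_axioms"
  shows "restriction_algebra (carrier A) (diff A) (restr A)"
proof -
  \<comment> \<open>Only the variables 0, 1 and 2 occur in the equations. Those in two variables are
    instantiated below with \<open>c = b\<close>, which keeps the valuation inside the
    carrier.\<close>
  have eq: "eval_term A (\<lambda>i. if i = 0 then a else if i = 1 then b else c) s
      = eval_term A (\<lambda>i. if i = 0 then a else if i = 1 then b else c) t"
    if "(s, t) \<in> dr_axioms" "a \<in> carrier A" "b \<in> carrier A" "c \<in> carrier A" for s t a b c
    using sat that unfolding satisfies_def by (force simp: image_subset_iff)
  note ax = eq[unfolded dr_axioms_def Let_def]
  show ?thesis
  proof
    fix a b assume ab: "a \<in> carrier A" "b \<in> carrier A"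
    then show "diff A a b \<in> carrier A" "restr A a b \<in> carrier A"
      using A by (auto simp: dr_algebra_def)
    show "diff A a (diff A b a) = a"
      using ax[of "Var 0 \<ominus> (Var 1 \<ominus> Var 0)" "Var 0" a b b] ab by simp
    show "diff A a (diff A a b) = diff A b (diff A b a)"
      using ax[of "Var 0 \<odot> Var 1" "Var 1 \<odot> Var 0" a b b] ab by simp
    show "restr A (diff A a (diff A a b)) a = diff A a (diff A a b)"
      using ax[of "(Var 0 \<odot> Var 1) \<triangleright> Var 0" "Var 0 \<odot> Var 1" a b b] ab by simp
    fix c assume c: "c \<in> carrier A"
    show "diff A (diff A a b) c = diff A (diff A a c) b"
      using ax[of "(Var 0 \<ominus> Var 1) \<ominus> Var 2" "(Var 0 \<ominus> Var 2) \<ominus> Var 1" a b c] ab c by simp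
    show "diff A (restr A a c) (diff A (restr A a c) (restr A b c)) = restr A (restr A a b) c"
      using ax[of "(Var 0 \<triangleright> Var 2) \<odot> (Var 1 \<triangleright> Var 2)" "(Var 0 \<triangleright> Var 1) \<triangleright> Var 2" a b c] ab c
      by simp
  qed
qed


section \<open>Soundness\<close>

lemma eval_term_closed:
  "dr_algebra A \<Longrightarrow> range v \<subseteq> carrier A \<Longrightarrow> eval_term A v t \<in> carrier A"
  by (induction t) (auto simp: dr_algebra_def)

lemma eval_term_iso:
  "dr_algebra A \<Longrightarrow> dr_iso h A B \<Longrightarrow> range v \<subseteq> carrier A \<Longrightarrow>
    h (eval_term A v t) = eval_term B (h \<circ> v) t"
  by (induction t) (simp_all add: dr_iso_def eval_term_closed)

text \<open>A valuation \<open>v\<close> is pushed forward to \<open>h \<circ> v\<close>, and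
  injectivity of \<open>h\<close> pulls the resulting identity back.\<close>

lemma satisfies_iso:
  assumes A: "dr_algebra A" and h: "dr_iso h A B" and sat: "satisfies B E"
  shows "satisfies A E"
  unfolding satisfies_def
proof (clarify)
  fix s t and v :: "nat \<Rightarrow> _" assume st: "(s, t) \<in> E" and v: "range v \<subseteq> carrier A"
  have inj: "inj_on h (carrier A)" and "h ` carrier A = carrier B"
    using h by (auto simp: dr_iso_def bij_betw_def)
  then have "range (h \<circ> v) \<subseteq> carrier B" using v by auto
  then have "eval_term B (h \<circ> v) s = eval_term B (h \<circ> v) t"
    using sat st by (auto simp: satisfies_def)
  then have "h (eval_term A v s) = h (eval_term A v t)"
    using eval_term_iso[OF A h v] by simp
  then show "eval_term A v s = eval_term A v t"
    using inj eval_term_closed[OF A v] by (auto dest: inj_onD)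
qed

lemma pf_algebra_satisfies:
  assumes P: "pf_algebra X Y P"
  shows "satisfies P dr_axioms"
  unfolding satisfies_def
proof (clarify)
  fix s t and v :: "nat \<Rightarrow> _" assume st: "(s, t) \<in> dr_axioms" and v: "range v \<subseteq> carrier P"
  have [simp]: "v i \<in> carrier P" for i using v by auto
  have [simp]: "diff P f g = f - g" "restr P f g = dom_restr f g"
      "f - g \<in> carrier P" "dom_restr f g \<in> carrier P"
    if "f \<in> carrier P" "g \<in> carrier P" for f g
    using P that unfolding pf_algebra_def dr_algebra_def by metis+
  have "single_valued (v i)" for i
    using P v by (auto simp: pf_algebra_def partial_functions_def)
  then have "y = z" if "(x, y) \<in> v i" "(x, z) \<in> v i" for i x y z
    using that by (meson single_valuedD)
  \<comment> \<open>Single-valuedness enters here: at a point in the domain of the meet, the only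
    value of \<open>v i\<close> already belongs to the meet.\<close>
  then have [simp]: "dom_restr (v i - (v i - v j)) (v i) = v i - (v i - v j)" for i j
    unfolding dom_restr_def by (safe; blast)
  have [simp]: "dom_restr (dom_restr f g) k
      = dom_restr f k - (dom_restr f k - dom_restr g k)" for f g k :: "('a \<times> 'b) set"
    by (auto simp: dom_restr_def)
  show "eval_term P v s = eval_term P v t"
    using st by (auto simp: dr_axioms_def Let_def)
qed

lemma satisfies_of_representable:
  assumes "dr_algebra A" "representable_over TYPE('x) TYPE('y) A"
  shows "satisfies A dr_axioms"
  using assms satisfies_iso pf_algebra_satisfies unfolding representable_over_def by blast

text \<open>Soundness holds over arbitrary base types, so no choice of them admits a representation
  violating the equations; completeness produces one over the types of the ultrafilter
  construction.\<close>

theorem theorem5p7: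
  fixes A :: "'a dr_algebra"
  assumes "dr_algebra A"
  shows "finite dr_axioms
    \<and> (representable_over TYPE('x) TYPE('y) A \<longrightarrow> satisfies A dr_axioms)
    \<and> (representable_over TYPE('a set set) TYPE('a set) A \<longleftrightarrow> satisfies A dr_axioms)"
proof -
  have "finite dr_axioms" by (simp add: dr_axioms_def Let_def)
  moreover have "representable_over TYPE('a set set) TYPE('a set) A"
    if "satisfies A dr_axioms"
    by (intro representable_of_axioms restriction_algebra_of_satisfies assms that)
  ultimately show ?thesis by (metis assms satisfies_of_representable)
qed

end
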